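(* Let $(\mathbb{R}^n,g)$ be a pseudo-Euclidean space, $n\geq 3$, with coordinates $x=(x_1,\dots,x_n)$ and $g_{ij}=\delta_{ij}\varepsilon_i$, $\varepsilon_i=\pm1$. Let $F$ be an Einstein semi-Riemannian manifold of dimension $m\geq 1$ with metric $g_F$ and constant Ricci curvature $\lambda_F$, i.e. $Ric_{g_F}=\lambda_F g_F$. Let $\psi,h:\mathbb{R}^n\to\mathbb{R}$ be smooth functions, $\psi$ nowhere zero, and consider the product manifold $M=(\mathbb{R}^n,g^* )\times F^m$ with metric $\tilde g=g^*+g_F$, where $g^*=\frac{1}{\psi^2}g$. Let $\rho,\tilde\lambda\in\mathbb{R}$. Then $M$ is a gradient $\rho$-Einstein soliton with potential function $h$ and constant $\tilde\lambda$, i.e. $$Ric_{\tilde g}+Hess_{\tilde g}h=\left(\rho K_{\tilde g}+\tilde\lambda\right)\tilde g,$$ if and only if $\psi$ and $h$ satisfy the following three conditions: (1) for all $i\neq j$ in $\{1,\dots,n\}$, $$(n-2)\psi_{,x_ix_j}+\psi h_{,x_ix_j}+\psi_{,x_i}h_{,x_j}+\psi_{,x_j}h_{,x_i}=0;$$ (2) for all $i=1,\dots,n$, $$\varepsilon_i\sum_{k=1}^{n}\varepsilon_k\left[\psi\psi_{,x_kx_k}-(n-1)(\psi_{,x_k})^2-\psi\psi_{,x_k}h_{,x_k}-2(n-1)\rho\psi\psi_{,x_kx_k}+(n-1)n\rho(\psi_{,x_k})^2\right]$$ $$+\left[(n-2)\psi\psi_{,x_ix_i}+\psi^2h_{,x_ix_i}+2\psi\psi_{,x_i}h_{,x_i}\right]=\left(\lambda_Fm\rho+\tilde\lambda\right)\varepsilon_i;$$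 (3) $$\sum_{k=1}^n\varepsilon_k\left((n-1)n\rho(\psi_{,x_k})^2-2(n-1)\rho\psi\psi_{,x_kx_k}\right)=\lambda_F(m\rho-1)+\tilde\lambda.$$
   Context: At least one $\varepsilon_i$ equals $1$. Subscripts after a comma denote partial derivatives: $\psi_{,x_i}=\partial\psi/\partial x_i$, $\psi_{,x_ix_j}=\partial^2\psi/\partial x_i\partial x_j$, and similarly for $h$. The function $h$ on $\mathbb{R}^n$ is regarded as a function on $M=\mathbb{R}^n\times F$ by composing with the projection onto $\mathbb{R}^n$. $Ric_{\tilde g}$, $Hess_{\tilde g}h$ and $K_{\tilde g}$ denote the Ricci tensor, the Hessian of $h$ and the scalar curvature with respect to $\tilde g$. *)

theory Defs
  imports "HOL-Analysis.Analysis"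
begin

section \<open>Partial derivatives and smooth functions\<close>

definition pderiv_at :: "'k::finite \<Rightarrow> (real^'k \<Rightarrow> real) \<Rightarrow> real^'k \<Rightarrow> real" where
  "pderiv_at i f x = deriv (\<lambda>t. f (x + t *\<^sub>R axis i 1)) 0"

text \<open>On an open set, \<open>C\<^sup>\<infinity>\<close> is equivalent to total differentiability of all iterated partial
  derivatives. Only the values of \<open>f\<close> on \<open>S\<close> matter.\<close>

definition smooth_fun_on :: "(real^'k::finite) set \<Rightarrow> (real^'k \<Rightarrow> real) \<Rightarrow> bool" where
  "smooth_fun_on S f \<longleftrightarrow> open S \<and> (\<forall>is. (foldr pderiv_at is f) differentiable_on S)"


section \<open>Semi-Riemannian manifolds\<close>

text \<open>A manifold is a whole topological space \<open>'p\<close> with an atlas of charts indexed by \<open>'c\<close>; the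
  metric is a type \<open>(0,2)\<close> tensor field in the classical sense, i.e. \<open>metric M c y\<close> is the matrix
  of components in chart \<open>c\<close> at the point with coordinates \<open>y\<close>, and these matrices obey the tensor
  transformation law. Values outside the chart domains carry no meaning.\<close>

record ('c, 'p, 'k::finite) manifold_data =
  chart_dom :: "'c \<Rightarrow> 'p set"
  chart :: "'c \<Rightarrow> 'p \<Rightarrow> real^'k"
  metric :: "'c \<Rightarrow> real^'k \<Rightarrow> real^'k^'k"

definition chart_img :: "('c, 'p, 'k::finite) manifold_data \<Rightarrow> 'c \<Rightarrow> (real^'k) set" where
  "chart_img M c = chart M c ` chart_dom M c"

definition param :: "('c, 'p, 'k::finite) manifold_data \<Rightarrow> 'c \<Rightarrow> real^'k \<Rightarrow> 'p" where
  "param M c = inv_into (chart_dom M c) (chart M c)"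

definition smooth_atlas ::
  "('c, 'p::{t2_space,second_countable_topology}, 'k::finite) manifold_data \<Rightarrow> bool" where
  "smooth_atlas M \<longleftrightarrow>
     (\<Union>c. chart_dom M c) = UNIV \<and>
     (\<forall>c. open (chart_dom M c) \<and> open (chart_img M c) \<and>
          homeomorphism (chart_dom M c) (chart_img M c) (chart M c) (param M c)) \<and>
     (\<forall>c d j. smooth_fun_on (chart M c ` (chart_dom M c \<inter> chart_dom M d))
                (\<lambda>y. chart M d (param M c y) $ j))"

definition negative_index :: "real^'k^'k::finite \<Rightarrow> nat" where
  "negative_index A =
     Max {dim S | S. subspace S \<and> (\<forall>v\<in>S. v \<noteq> 0 \<longrightarrow> v \<bullet> (A *v v) < 0)}"

definition metric_tensor ::
  "('c, 'p::{t2_space,second_countable_topology}, 'k::finite) manifold_data \<Rightarrow> bool" where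
  "metric_tensor M \<longleftrightarrow>
     (\<forall>c i j. smooth_fun_on (chart_img M c) (\<lambda>y. metric M c y $ i $ j)) \<and>
     (\<forall>c. \<forall>y\<in>chart_img M c.
        transpose (metric M c y) = metric M c y \<and> invertible (metric M c y)) \<and>
     (\<exists>q. \<forall>c. \<forall>y\<in>chart_img M c. negative_index (metric M c y) = q) \<and>
     (\<forall>c d. \<forall>y\<in>chart M c ` (chart_dom M c \<inter> chart_dom M d). \<forall>i j.
        metric M c y $ i $ j =
          (\<Sum>k\<in>UNIV. \<Sum>l\<in>UNIV.
             pderiv_at i (\<lambda>z. chart M d (param M c z) $ k) y *
             pderiv_at j (\<lambda>z. chart M d (param M c z) $ l) y *
             metric M d (chart M d (param M c y)) $ k $ l))"

definition semi_riemannian_manifold ::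
  "('c, 'p::{t2_space,second_countable_topology}, 'k::finite) manifold_data \<Rightarrow> bool" where
  "semi_riemannian_manifold M \<longleftrightarrow> smooth_atlas M \<and> metric_tensor M"


section \<open>Curvature and Hessian in local coordinates\<close>

text \<open>\<open>christoffel G l i j\<close> is \<open>\<Gamma>\<close> with upper index \<open>l\<close> and lower indices \<open>i\<close>, \<open>j\<close>.\<close>

definition christoffel ::
  "(real^'k \<Rightarrow> real^'k^'k) \<Rightarrow> 'k \<Rightarrow> 'k \<Rightarrow> 'k \<Rightarrow> real^'k::finite \<Rightarrow> real" where
  "christoffel G l i j y =
     (\<Sum>s\<in>UNIV. matrix_inv (G y) $ l $ s *
        (pderiv_at i (\<lambda>z. G z $ j $ s) y + pderiv_at j (\<lambda>z. G z $ i $ s) y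
         - pderiv_at s (\<lambda>z. G z $ i $ j) y)) / 2"

text \<open>\<open>riemann G l k i j\<close> is the \<open>l\<close>-th component of
  \<open>R(\<partial>\<^sub>i, \<partial>\<^sub>j)\<partial>\<^sub>k = \<nabla>\<^sub>i\<nabla>\<^sub>j\<partial>\<^sub>k - \<nabla>\<^sub>j\<nabla>\<^sub>i\<partial>\<^sub>k\<close>; with the contraction used in \<open>ricci\<close> the round
  sphere has positive Ricci curvature.\<close>

definition riemann ::
  "(real^'k \<Rightarrow> real^'k^'k) \<Rightarrow> 'k \<Rightarrow> 'k \<Rightarrow> 'k \<Rightarrow> 'k \<Rightarrow> real^'k::finite \<Rightarrow> real" where
  "riemann G l k i j y =
     pderiv_at i (christoffel G l j k) y - pderiv_at j (christoffel G l i k) y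
     + (\<Sum>s\<in>UNIV. christoffel G l i s y * christoffel G s j k y
                  - christoffel G l j s y * christoffel G s i k y)"

definition ricci :: "(real^'k \<Rightarrow> real^'k^'k) \<Rightarrow> real^'k \<Rightarrow> real^'k^'k::finite" where
  "ricci G y = (\<chi> j k. \<Sum>i\<in>UNIV. riemann G i k i j y)"

definition scalar_curvature :: "(real^'k \<Rightarrow> real^'k^'k) \<Rightarrow> real^'k::finite \<Rightarrow> real" where
  "scalar_curvature G y =
     (\<Sum>i\<in>UNIV. \<Sum>j\<in>UNIV. matrix_inv (G y) $ i $ j * ricci G y $ i $ j)"

definition hessian ::
  "(real^'k \<Rightarrow> real^'k^'k) \<Rightarrow> (real^'k \<Rightarrow> real) \<Rightarrow> real^'k \<Rightarrow> real^'k^'k::finite" where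
  "hessian G f y =
     (\<chi> i j. pderiv_at i (pderiv_at j f) y
            - (\<Sum>l\<in>UNIV. christoffel G l i j y * pderiv_at l f y))"


section \<open>Einstein manifolds and gradient rho-Einstein solitons\<close>

definition einstein_manifold ::
  "('c, 'p::{t2_space,second_countable_topology}, 'k::finite) manifold_data \<Rightarrow> real \<Rightarrow> bool" where
  "einstein_manifold M lam \<longleftrightarrow> semi_riemannian_manifold M \<and>
     (\<forall>c. \<forall>y\<in>chart_img M c. ricci (metric M c) y = lam *\<^sub>R metric M c y)"

definition gradient_rho_einstein_soliton ::
  "('c, 'p, 'k::finite) manifold_data \<Rightarrow> real \<Rightarrow> ('p \<Rightarrow> real) \<Rightarrow> real \<Rightarrow> bool" where
  "gradient_rho_einstein_soliton M rho f lam \<longleftrightarrow>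
     (\<forall>c. \<forall>y\<in>chart_img M c.
        ricci (metric M c) y + hessian (metric M c) (f \<circ> param M c) y =
          (rho * scalar_curvature (metric M c) y + lam) *\<^sub>R metric M c y)"


section \<open>Pseudo-Euclidean space, conformal change, products\<close>

definition pseudo_euclidean :: "('k \<Rightarrow> real) \<Rightarrow> (unit, real^'k, 'k::finite) manifold_data" where
  "pseudo_euclidean \<epsilon> =
     \<lparr>chart_dom = (\<lambda>_. UNIV), chart = (\<lambda>_ x. x),
      metric = (\<lambda>_ _. \<chi> i j. if i = j then \<epsilon> i else 0)\<rparr>"

text \<open>Replaces the metric \<open>g\<close> by \<open>(1/\<psi>\<^sup>2) g\<close>.\<close>

definition conformal_change ::
  "('p \<Rightarrow> real) \<Rightarrow> ('c, 'p, 'k::finite) manifold_data \<Rightarrow> ('c, 'p, 'k) manifold_data" where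
  "conformal_change \<psi> M =
     M\<lparr>metric := (\<lambda>c y. (1 / (\<psi> (param M c y))\<^sup>2) *\<^sub>R metric M c y)\<rparr>"

definition left_part :: "real^('k::finite + 'l::finite) \<Rightarrow> real^'k" where
  "left_part z = (\<chi> i. z $ Inl i)"

definition right_part :: "real^('k::finite + 'l::finite) \<Rightarrow> real^'l" where
  "right_part z = (\<chi> j. z $ Inr j)"

definition join_coords :: "real^'k::finite \<Rightarrow> real^'l::finite \<Rightarrow> real^('k + 'l)" where
  "join_coords u v = (\<chi> a. case a of Inl i \<Rightarrow> u $ i | Inr j \<Rightarrow> v $ j)"

text \<open>The product atlas consists of the products of charts; in such a chart the metric
  \<open>g\<^sub>M + g\<^sub>N\<close> (sum of the pullbacks along the projections) is block diagonal.\<close>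

definition product_manifold ::
  "('c, 'p, 'k::finite) manifold_data \<Rightarrow> ('d, 'q, 'l::finite) manifold_data \<Rightarrow>
   ('c \<times> 'd, 'p \<times> 'q, 'k + 'l) manifold_data" where
  "product_manifold M N =
     \<lparr>chart_dom = (\<lambda>(c, d). chart_dom M c \<times> chart_dom N d),
      chart = (\<lambda>(c, d) (p, q). join_coords (chart M c p) (chart N d q)),
      metric = (\<lambda>(c, d) z. \<chi> a b. case (a, b) of
          (Inl i, Inl j) \<Rightarrow> metric M c (left_part z) $ i $ j
        | (Inr i, Inr j) \<Rightarrow> metric N d (right_part z) $ i $ j
        | _ \<Rightarrow> 0)\<rparr>"

end

theory Submission
  imports Defs
begin

text \<open>In a product chart the metric \<open>g\<^sup>* + g\<^sub>F\<close> is block diagonal, and each block depends only on its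
  own group of coordinates. Hence the mixed Christoffel symbols vanish, the Ricci tensor is the block
  matrix of the two Ricci tensors, the scalar curvature is the sum of the two, and the Hessian of a
  function lifted from the base lives in the base block alone (\<open>ricci_block_metric\<close>,
  \<open>scalar_curvature_block_metric\<close>, \<open>hessian_block_metric_left\<close>). With
  \<open>\<mu> = \<rho> (K\<^bsub>g\<^sup>*\<^esub> + m \<lambda>\<^sub>F) + \<lambda>\<close>, a function on the base, the soliton equation therefore splits into
  \<open>Ric\<^bsub>g\<^sup>*\<^esub> + Hess\<^bsub>g\<^sup>*\<^esub> h = \<mu> g\<^sup>*\<close> on the base and \<open>\<lambda>\<^sub>F g\<^sub>F = \<mu> g\<^sub>F\<close> on the fibre; since \<open>g\<^sub>F\<close> is
  nondegenerate and \<open>m \<ge> 1\<close>, the latter says \<open>\<lambda>\<^sub>F = \<mu>\<close>.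

  The base is conformally flat, so both tensors are explicit. With \<open>u = d\<psi> / \<psi>\<close>, the Laplacian
  \<open>\<Delta>\<psi> = \<Sum>\<epsilon>\<^sub>k \<psi>\<^sub>k\<^sub>k\<close> and \<open>|\<nabla>\<psi>|\<^sup>2 = \<Sum>\<epsilon>\<^sub>k \<psi>\<^sub>k\<^sup>2\<close>, one finds
  \<open>Ric\<^sub>j\<^sub>k = (n - 2) \<psi>\<^sub>j\<^sub>k / \<psi> + \<epsilon>\<^sub>j \<delta>\<^sub>j\<^sub>k (\<Delta>\<psi> / \<psi> - (n - 1) |\<nabla>\<psi>|\<^sup>2 / \<psi>\<^sup>2)\<close> (\<open>ricci_G\<close>),
  \<open>K = (n - 1) (2 \<psi> \<Delta>\<psi> - n |\<nabla>\<psi>|\<^sup>2)\<close> (\<open>scalar_curvature_G\<close>) and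
  \<open>Hess\<^sub>i\<^sub>j h = h\<^sub>i\<^sub>j + u\<^sub>i h\<^sub>j + u\<^sub>j h\<^sub>i - \<epsilon>\<^sub>i \<delta>\<^sub>i\<^sub>j \<Sum>\<epsilon>\<^sub>k u\<^sub>k h\<^sub>k\<close> (\<open>hessian_G\<close>).
  The off-diagonal entries of the base equation, times \<open>\<psi>\<close>, are the first condition; its diagonal
  entries, times \<open>\<psi>\<^sup>2\<close>, become the second when the part of \<open>\<mu>\<close> that involves \<open>\<psi>\<close> is moved to the
  left; and \<open>\<lambda>\<^sub>F = \<mu>\<close> is the third. The fibre is not empty, so every point of the base occurs
  in some chart of the product and the pointwise equivalence becomes the theorem.\<close>

section \<open>Partial derivatives\<close>

lemma has_real_derivative_pderiv_at:
  fixes f :: "real^'k::finite \<Rightarrow> real"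
  assumes "f differentiable at (p + s *\<^sub>R axis i 1)"
  shows "((\<lambda>r. f (p + r *\<^sub>R axis i 1)) has_real_derivative pderiv_at i f (p + s *\<^sub>R axis i 1)) (at s)"
proof -
  let ?e = "axis i 1 :: real^'k"
  have "(\<lambda>t. f (p + s *\<^sub>R ?e + t *\<^sub>R ?e)) differentiable at 0"
    by (rule differentiable_compose[of f]) (use assms in auto)
  hence "((\<lambda>t. f (p + s *\<^sub>R ?e + t *\<^sub>R ?e)) has_real_derivative pderiv_at i f (p + s *\<^sub>R ?e)) (at 0)"
    by (simp add: pderiv_at_def DERIV_deriv_iff_real_differentiable)
  thus ?thesis
    using DERIV_shift[of "\<lambda>r. f (p + r *\<^sub>R ?e)" _ 0 s]
    by (simp add: add.commute scaleR_add_left add.left_commute)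
qed

lemma pderiv_at_eqI:
  assumes "((\<lambda>t. f (x + t *\<^sub>R axis i 1)) has_real_derivative D) (at 0)"
  shows "pderiv_at i f x = D"
  using assms by (simp add: pderiv_at_def DERIV_imp_deriv)

text \<open>Charts matter only on open sets: metric components, Christoffel symbols and the potential are
  known only on the image of a chart, and this is what lets them be differentiated there.\<close>

lemma pderiv_at_cong:
  fixes f g :: "real^'k::finite \<Rightarrow> real"
  assumes "open S" "x \<in> S" "\<And>y. y \<in> S \<Longrightarrow> f y = g y"
  shows "pderiv_at i f x = pderiv_at i g x"
proof -
  have "((\<lambda>t::real. x + t *\<^sub>R axis i 1) \<longlongrightarrow> x + 0 *\<^sub>R axis i 1) (nhds 0)"
    by (intro tendsto_intros filterlim_ident)
  hence "eventually (\<lambda>t. x + t *\<^sub>R axis i 1 \<in> S) (nhds (0::real))"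
    using assms(1,2) by (auto dest: topological_tendstoD)
  hence "eventually (\<lambda>t. f (x + t *\<^sub>R axis i 1) = g (x + t *\<^sub>R axis i 1)) (nhds 0)"
    by eventually_elim (use assms(3) in blast)
  thus ?thesis unfolding pderiv_at_def by (intro deriv_cong_ev) auto
qed

lemma pderiv_at_const [simp]: "pderiv_at i (\<lambda>_. c) = (\<lambda>_. 0)"
  by (simp add: pderiv_at_def fun_eq_iff)

lemma smooth_fun_on_differentiable:
  assumes "smooth_fun_on S f" "x \<in> S"
  shows "f differentiable at x" "pderiv_at i f differentiable at x"
    "pderiv_at j (pderiv_at i f) differentiable at x"
proof -
  have *: "(foldr pderiv_at is f) differentiable at x" for "is"
    using assms unfolding smooth_fun_on_def differentiable_on_def
    by (metis at_within_open)
  show "f differentiable at x" "pderiv_at i f differentiable at x"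
    "pderiv_at j (pderiv_at i f) differentiable at x"
    using *[of "[]"] *[of "[i]"] *[of "[j, i]"] by simp_all
qed

text \<open>The mean value theorem, applied first in direction \<open>i\<close> to
  \<open>s \<mapsto> f (x + s e\<^sub>i + t e\<^sub>j) - f (x + s e\<^sub>i)\<close> and then in direction \<open>j\<close>. The left-hand side is symmetric
  in \<open>i\<close> and \<open>j\<close>, which is why mixed partial derivatives commute.\<close>

lemma second_difference_eq_second_pderiv_at:
  fixes f :: "real^'k::finite \<Rightarrow> real"
  assumes "t > 0"
    and f: "\<And>a b. 0 \<le> a \<Longrightarrow> a \<le> t \<Longrightarrow> 0 \<le> b \<Longrightarrow> b \<le> t \<Longrightarrow>
              f differentiable at (x + a *\<^sub>R axis i 1 + b *\<^sub>R axis j 1)"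
    and fi: "\<And>a b. 0 \<le> a \<Longrightarrow> a \<le> t \<Longrightarrow> 0 \<le> b \<Longrightarrow> b \<le> t \<Longrightarrow>
              pderiv_at i f differentiable at (x + a *\<^sub>R axis i 1 + b *\<^sub>R axis j 1)"
  shows "\<exists>a b. 0 < a \<and> a < t \<and> 0 < b \<and> b < t \<and>
    f (x + t *\<^sub>R axis i 1 + t *\<^sub>R axis j 1) - f (x + t *\<^sub>R axis i 1)
      - f (x + t *\<^sub>R axis j 1) + f x
    = t\<^sup>2 * pderiv_at j (pderiv_at i f) (x + a *\<^sub>R axis i 1 + b *\<^sub>R axis j 1)"
proof -
  let ?i = "axis i 1 :: real^'k" and ?j = "axis j 1 :: real^'k"
  let ?g = "\<lambda>s. f (x + s *\<^sub>R ?i + t *\<^sub>R ?j) - f (x + s *\<^sub>R ?i)"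
  have g: "(?g has_real_derivative
      pderiv_at i f (x + s *\<^sub>R ?i + t *\<^sub>R ?j) - pderiv_at i f (x + s *\<^sub>R ?i)) (at s)"
    if "0 \<le> s" "s \<le> t" for s
  proof (rule DERIV_diff)
    show "((\<lambda>s. f (x + s *\<^sub>R ?i + t *\<^sub>R ?j)) has_real_derivative
        pderiv_at i f (x + s *\<^sub>R ?i + t *\<^sub>R ?j)) (at s)"
      using has_real_derivative_pderiv_at[of f "x + t *\<^sub>R ?j" s i] f[of s t] that \<open>t > 0\<close>
      by (simp add: add_ac)
    show "((\<lambda>s. f (x + s *\<^sub>R ?i)) has_real_derivative pderiv_at i f (x + s *\<^sub>R ?i)) (at s)"
      using has_real_derivative_pderiv_at[of f x s i] f[of s 0] that \<open>t > 0\<close> by simp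
  qed
  obtain a where a: "0 < a" "a < t" and
    ga: "?g t - ?g 0 = (t - 0) * (pderiv_at i f (x + a *\<^sub>R ?i + t *\<^sub>R ?j) - pderiv_at i f (x + a *\<^sub>R ?i))"
    using MVT2[OF \<open>t > 0\<close> g] by metis
  have k: "((\<lambda>b. pderiv_at i f (x + a *\<^sub>R ?i + b *\<^sub>R ?j)) has_real_derivative
      pderiv_at j (pderiv_at i f) (x + a *\<^sub>R ?i + b *\<^sub>R ?j)) (at b)" if "0 \<le> b" "b \<le> t" for b
    using has_real_derivative_pderiv_at[of "pderiv_at i f" "x + a *\<^sub>R ?i" b j] fi[of a b] that a
    by simp
  obtain b where b: "0 < b" "b < t" and
    "pderiv_at i f (x + a *\<^sub>R ?i + t *\<^sub>R ?j) - pderiv_at i f (x + a *\<^sub>R ?i + 0 *\<^sub>R ?j)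
      = (t - 0) * pderiv_at j (pderiv_at i f) (x + a *\<^sub>R ?i + b *\<^sub>R ?j)"
    using MVT2[OF \<open>t > 0\<close> k] by metis
  with ga have "?g t - ?g 0 = t\<^sup>2 * pderiv_at j (pderiv_at i f) (x + a *\<^sub>R ?i + b *\<^sub>R ?j)"
    by (simp add: power2_eq_square)
  with a b show ?thesis by (intro exI[of _ a] exI[of _ b]) simp
qed

text \<open>If the two mixed derivatives differed at \<open>x\<close> by \<open>2 e\<close>, then on a square at \<open>x\<close> small enough that
  each stays within \<open>e\<close> of its value at \<open>x\<close> they could not agree; but the second difference over the
  square equals \<open>t\<^sup>2\<close> times a value of either one.\<close>

lemma pderiv_at_commute:
  fixes f :: "real^'k::finite \<Rightarrow> real"
  assumes f: "smooth_fun_on S f" and x: "x \<in> S"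
  shows "pderiv_at j (pderiv_at i f) x = pderiv_at i (pderiv_at j f) x"
proof (rule ccontr)
  let ?i = "axis i 1 :: real^'k" and ?j = "axis j 1 :: real^'k"
  let ?A = "pderiv_at j (pderiv_at i f)" and ?B = "pderiv_at i (pderiv_at j f)"
  assume "?A x \<noteq> ?B x"
  define e where "e = \<bar>?A x - ?B x\<bar> / 2"
  with \<open>?A x \<noteq> ?B x\<close> have "e > 0" by simp
  have "open S" using f by (simp add: smooth_fun_on_def)
  have "isCont ?A x" "isCont ?B x"
    using smooth_fun_on_differentiable(3)[OF f x] differentiable_imp_continuous_within by blast+
  then obtain d1 d2 where d1: "d1 > 0" "\<And>y. dist y x < d1 \<Longrightarrow> dist (?A y) (?A x) < e"
    and d2: "d2 > 0" "\<And>y. dist y x < d2 \<Longrightarrow> dist (?B y) (?B x) < e"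
    using \<open>e > 0\<close> unfolding continuous_at_eps_delta by metis
  obtain d3 where d3: "d3 > 0" "\<And>y. dist y x < d3 \<Longrightarrow> y \<in> S"
    using \<open>open S\<close> x unfolding open_dist by metis
  \<comment> \<open>the square \<open>x + a e\<^sub>p + b e\<^sub>q\<close> with \<open>0 \<le> a, b \<le> t\<close> lies within distance \<open>2 t < 3 t\<close> of \<open>x\<close>\<close>
  define t where "t = Min {d1, d2, d3} / 3"
  have t: "t > 0" "3 * t \<le> d1" "3 * t \<le> d2" "3 * t \<le> d3"
    using d1(1) d2(1) d3(1) by (auto simp: t_def)
  have near: "dist (x + a *\<^sub>R axis p 1 + b *\<^sub>R axis q 1) x < 3 * t"
    if "0 \<le> a" "a \<le> t" "0 \<le> b" "b \<le> t" for a b p q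
  proof -
    have "norm (a *\<^sub>R (axis p 1 :: real^'k) + b *\<^sub>R axis q 1) \<le> a + b"
      using norm_triangle_ineq[of "a *\<^sub>R (axis p 1 :: real^'k)" "b *\<^sub>R axis q 1"] that
      by (simp add: norm_axis_1)
    thus ?thesis using that t(1) by (simp add: dist_norm add.assoc)
  qed
  have inS: "x + a *\<^sub>R axis p 1 + b *\<^sub>R axis q 1 \<in> S"
    if "0 \<le> a" "a \<le> t" "0 \<le> b" "b \<le> t" for a b p q
    by (rule d3(2)[OF less_le_trans[OF near[OF that] t(4)]])
  note sq = second_difference_eq_second_pderiv_at[OF t(1)
      smooth_fun_on_differentiable(1)[OF f inS] smooth_fun_on_differentiable(2)[OF f inS]]
  obtain a b where ab: "0 < a" "a < t" "0 < b" "b < t"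
    "f (x + t *\<^sub>R ?i + t *\<^sub>R ?j) - f (x + t *\<^sub>R ?i) - f (x + t *\<^sub>R ?j) + f x
      = t\<^sup>2 * ?A (x + a *\<^sub>R ?i + b *\<^sub>R ?j)"
    using sq[of i j] by auto
  obtain a' b' where ab': "0 < a'" "a' < t" "0 < b'" "b' < t"
    "f (x + t *\<^sub>R ?j + t *\<^sub>R ?i) - f (x + t *\<^sub>R ?j) - f (x + t *\<^sub>R ?i) + f x
      = t\<^sup>2 * ?B (x + a' *\<^sub>R ?j + b' *\<^sub>R ?i)"
    using sq[of j i] by auto
  have swap: "x + r *\<^sub>R ?j + s *\<^sub>R ?i = x + s *\<^sub>R ?i + r *\<^sub>R ?j" for r s
    by simp
  have "t\<^sup>2 * ?A (x + a *\<^sub>R ?i + b *\<^sub>R ?j) = t\<^sup>2 * ?B (x + b' *\<^sub>R ?i + a' *\<^sub>R ?j)"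
    using ab(5) ab'(5) unfolding swap by linarith
  hence eq: "?A (x + a *\<^sub>R ?i + b *\<^sub>R ?j) = ?B (x + b' *\<^sub>R ?i + a' *\<^sub>R ?j)"
    using t(1) by simp
  have "dist (?A (x + a *\<^sub>R ?i + b *\<^sub>R ?j)) (?A x) < e"
    using near[of a b i j] ab t by (intro d1(2)) simp
  moreover have "dist (?B (x + b' *\<^sub>R ?i + a' *\<^sub>R ?j)) (?B x) < e"
    using near[of b' a' i j] ab' t by (intro d2(2)) simp
  ultimately have "dist (?A x) (?B x) < \<bar>?A x - ?B x\<bar>"
    unfolding eq e_def by (rule dist_triangle_half_r)
  thus False by (simp add: dist_real_def)
qed

section \<open>Block-diagonal metrics\<close>

definition block_matrix :: "real^'k^'k \<Rightarrow> real^'l^'l \<Rightarrow> real^('k::finite + 'l::finite)^('k + 'l)" where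
  "block_matrix A B = (\<chi> a b. case (a, b) of
      (Inl i, Inl j) \<Rightarrow> A $ i $ j
    | (Inr i, Inr j) \<Rightarrow> B $ i $ j
    | _ \<Rightarrow> 0)"

definition block_metric ::
  "(real^'k \<Rightarrow> real^'k^'k) \<Rightarrow> (real^'l \<Rightarrow> real^'l^'l) \<Rightarrow>
   real^('k::finite + 'l::finite) \<Rightarrow> real^('k + 'l)^('k + 'l)" where
  "block_metric G H z = block_matrix (G (left_part z)) (H (right_part z))"

lemma block_matrix_nth [simp]:
  "block_matrix A B $ Inl i $ Inl j = A $ i $ j"
  "block_matrix A B $ Inr p $ Inr q = B $ p $ q"
  "block_matrix A B $ Inl i $ Inr q = 0"
  "block_matrix A B $ Inr p $ Inl j = 0"
  by (simp_all add: block_matrix_def)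

lemma sum_UNIV_Plus:
  fixes f :: "'k::finite + 'l::finite \<Rightarrow> 'a::comm_monoid_add"
  shows "sum f UNIV = (\<Sum>i\<in>UNIV. f (Inl i)) + (\<Sum>j\<in>UNIV. f (Inr j))"
  using sum.Plus[of "UNIV :: 'k set" "UNIV :: 'l set" f] by simp

lemma all_Plus: "(\<forall>a. P a) \<longleftrightarrow> (\<forall>i. P (Inl i)) \<and> (\<forall>j. P (Inr j))"
  by (metis sum.exhaust)

lemma matrix_inv_inverse:
  assumes "invertible A"
  shows "A ** matrix_inv A = mat 1" "matrix_inv A ** A = mat 1"
  using someI_ex[OF assms[unfolded invertible_def]] by (simp_all add: matrix_inv_def)

lemma matrix_inv_eqI:
  fixes A B :: "real^'k^'k::finite"
  assumes "A ** B = mat 1"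
  shows "matrix_inv A = B"
proof -
  have "B ** A = mat 1" using assms matrix_left_right_inverse by blast
  hence "invertible A" using assms by (auto simp: invertible_def)
  hence "(matrix_inv A ** A) ** B = B" by (simp add: matrix_inv_inverse)
  thus ?thesis by (simp add: assms flip: matrix_mul_assoc)
qed

lemma matrix_inv_block_matrix:
  assumes "invertible A" "invertible B"
  shows "matrix_inv (block_matrix A B) = block_matrix (matrix_inv A) (matrix_inv B)"
proof (rule matrix_inv_eqI)
  have "(A ** matrix_inv A) $ i $ j = (if i = j then 1 else 0)"
       "(B ** matrix_inv B) $ p $ q = (if p = q then 1 else 0)" for i j p q
    using assms by (simp_all add: matrix_inv_inverse mat_def)
  thus "block_matrix A B ** block_matrix (matrix_inv A) (matrix_inv B) = mat 1"
    by (simp add: vec_eq_iff all_Plus mat_def matrix_matrix_mult_def sum_UNIV_Plus)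
qed

lemma left_right_part_axis [simp]:
  "left_part (z + t *\<^sub>R axis (Inl i) 1) = left_part z + t *\<^sub>R axis i 1"
  "right_part (z + t *\<^sub>R axis (Inl i) 1) = right_part z"
  "left_part (z + t *\<^sub>R axis (Inr j) 1) = left_part z"
  "right_part (z + t *\<^sub>R axis (Inr j) 1) = right_part z + t *\<^sub>R axis j 1"
  by (simp_all add: vec_eq_iff left_part_def right_part_def axis_def)

text \<open>Moving along one factor leaves the coordinates of the other fixed, so these equations hold for
  all functions. Through them every derivative in the curvature of a block metric reduces to one
  in a single factor.\<close>

lemma pderiv_at_part [simp]:
  "pderiv_at (Inl i) (\<lambda>z. f (left_part z)) = (\<lambda>z. pderiv_at i f (left_part z))"
  "pderiv_at (Inr j) (\<lambda>z. f (left_part z)) = (\<lambda>z. 0)"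
  "pderiv_at (Inl i) (\<lambda>z. g (right_part z)) = (\<lambda>z. 0)"
  "pderiv_at (Inr j) (\<lambda>z. g (right_part z)) = (\<lambda>z. pderiv_at j g (right_part z))"
  by (simp_all add: pderiv_at_def fun_eq_iff)

lemma christoffel_block_metric:
  assumes "invertible (G (left_part z))" "invertible (H (right_part z))"
  shows
    "christoffel (block_metric G H) (Inl l) (Inl i) (Inl j) z = christoffel G l i j (left_part z)"
    "christoffel (block_metric G H) (Inr p) (Inr q) (Inr r) z = christoffel H p q r (right_part z)"
    "christoffel (block_metric G H) (Inl l) (Inl i) (Inr r) z = 0"
    "christoffel (block_metric G H) (Inl l) (Inr q) (Inl j) z = 0"
    "christoffel (block_metric G H) (Inl l) (Inr q) (Inr r) z = 0"
    "christoffel (block_metric G H) (Inr p) (Inl i) (Inl j) z = 0"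
    "christoffel (block_metric G H) (Inr p) (Inl i) (Inr r) z = 0"
    "christoffel (block_metric G H) (Inr p) (Inr q) (Inl j) z = 0"
proof -
  have pl [simp]: "pderiv_at c (\<lambda>z. G (left_part z) $ i $ j) =
      (case c of Inl a \<Rightarrow> (\<lambda>z. pderiv_at a (\<lambda>x. G x $ i $ j) (left_part z)) | Inr b \<Rightarrow> (\<lambda>z. 0))"
    for c :: "'a + 'b" and i j
    using pderiv_at_part(1,2)[of _ "\<lambda>x. G x $ i $ j"] by (cases c) auto
  have pr [simp]: "pderiv_at c (\<lambda>z. H (right_part z) $ i $ j) =
      (case c of Inl a \<Rightarrow> (\<lambda>z. 0) | Inr b \<Rightarrow> (\<lambda>z. pderiv_at b (\<lambda>x. H x $ i $ j) (right_part z)))"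
    for c :: "'a + 'b" and i j
    using pderiv_at_part(3,4)[of _ "\<lambda>x. H x $ i $ j"] by (cases c) auto
  show
    "christoffel (block_metric G H) (Inl l) (Inl i) (Inl j) z = christoffel G l i j (left_part z)"
    "christoffel (block_metric G H) (Inr p) (Inr q) (Inr r) z = christoffel H p q r (right_part z)"
    "christoffel (block_metric G H) (Inl l) (Inl i) (Inr r) z = 0"
    "christoffel (block_metric G H) (Inl l) (Inr q) (Inl j) z = 0"
    "christoffel (block_metric G H) (Inl l) (Inr q) (Inr r) z = 0"
    "christoffel (block_metric G H) (Inr p) (Inl i) (Inl j) z = 0"
    "christoffel (block_metric G H) (Inr p) (Inl i) (Inr r) z = 0"
    "christoffel (block_metric G H) (Inr p) (Inr q) (Inl j) z = 0"
    using assms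
    by (simp_all add: christoffel_def block_metric_def matrix_inv_block_matrix sum_UNIV_Plus)
qed

text \<open>The Christoffel symbols split only where both blocks are invertible. Since they are
  differentiated once more, this must hold on a neighbourhood of \<open>z\<close>, hence the open set \<open>S\<close>.\<close>

lemma ricci_block_metric:
  assumes S: "open S" "z \<in> S"
    and inv: "\<And>z. z \<in> S \<Longrightarrow> invertible (G (left_part z))"
             "\<And>z. z \<in> S \<Longrightarrow> invertible (H (right_part z))"
  shows "ricci (block_metric G H) z = block_matrix (ricci G (left_part z)) (ricci H (right_part z))"
proof -
  note chr = christoffel_block_metric[where G = G and H = H, OF inv]
  note pcong = pderiv_at_cong[OF S]
  have p:
    "pderiv_at c (christoffel (block_metric G H) (Inl l) (Inl i) (Inl j)) z
       = pderiv_at c (\<lambda>z. christoffel G l i j (left_part z)) z"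
    "pderiv_at c (christoffel (block_metric G H) (Inr p) (Inr q) (Inr r)) z
       = pderiv_at c (\<lambda>z. christoffel H p q r (right_part z)) z"
    "pderiv_at c (christoffel (block_metric G H) (Inl l) (Inl i) (Inr r)) z = 0"
    "pderiv_at c (christoffel (block_metric G H) (Inl l) (Inr q) (Inl j)) z = 0"
    "pderiv_at c (christoffel (block_metric G H) (Inl l) (Inr q) (Inr r)) z = 0"
    "pderiv_at c (christoffel (block_metric G H) (Inr p) (Inl i) (Inl j)) z = 0"
    "pderiv_at c (christoffel (block_metric G H) (Inr p) (Inl i) (Inr r)) z = 0"
    "pderiv_at c (christoffel (block_metric G H) (Inr p) (Inr q) (Inl j)) z = 0"
    for c l i j p q r
    by (subst pcong[OF chr(1)] pcong[OF chr(2)] pcong[OF chr(3)] pcong[OF chr(4)]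
          pcong[OF chr(5)] pcong[OF chr(6)] pcong[OF chr(7)] pcong[OF chr(8)]; simp)+
  show ?thesis
    using S(2)
    by (simp add: vec_eq_iff all_Plus ricci_def riemann_def sum_UNIV_Plus p chr)
qed

lemma scalar_curvature_block_metric:
  assumes S: "open S" "z \<in> S"
    and inv: "\<And>z. z \<in> S \<Longrightarrow> invertible (G (left_part z))"
             "\<And>z. z \<in> S \<Longrightarrow> invertible (H (right_part z))"
  shows "scalar_curvature (block_metric G H) z
    = scalar_curvature G (left_part z) + scalar_curvature H (right_part z)"
proof -
  have "matrix_inv (block_metric G H z)
      = block_matrix (matrix_inv (G (left_part z))) (matrix_inv (H (right_part z)))"
    unfolding block_metric_def using S(2) inv by (intro matrix_inv_block_matrix)
  thus ?thesis
    by (simp add: scalar_curvature_def ricci_block_metric[where G = G and H = H, OF assms] sum_UNIV_Plus)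
qed

lemma hessian_cong:
  assumes S: "open S" "x \<in> S" and eq: "\<And>y. y \<in> S \<Longrightarrow> f y = g y"
  shows "hessian G f x = hessian G g x"
proof -
  have 1: "pderiv_at i f y = pderiv_at i g y" if "y \<in> S" for i y
    using pderiv_at_cong[OF S(1) that eq] .
  have "pderiv_at j (pderiv_at i f) x = pderiv_at j (pderiv_at i g) x" for i j
    using pderiv_at_cong[OF S 1] .
  with 1 S(2) show ?thesis by (simp add: hessian_def)
qed

lemma hessian_block_metric_left:
  assumes "invertible (G (left_part z))" "invertible (H (right_part z))"
  shows "hessian (block_metric G H) (\<lambda>z. f (left_part z)) z
    = block_matrix (hessian G f (left_part z)) 0"
  by (simp add: vec_eq_iff all_Plus hessian_def sum_UNIV_Plus christoffel_block_metric[where G = G and H = H, OF assms])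

section \<open>Conformally flat metrics\<close>

definition conformally_flat_metric ::
  "('k::finite \<Rightarrow> real) \<Rightarrow> (real^'k \<Rightarrow> real) \<Rightarrow> real^'k \<Rightarrow> real^'k^'k" where
  "conformally_flat_metric \<epsilon> \<psi> x = (1 / (\<psi> x)\<^sup>2) *\<^sub>R (\<chi> i j. if i = j then \<epsilon> i else 0)"

lemma pderiv_at_inverse_square:
  assumes "\<psi> differentiable at x" "\<psi> x \<noteq> 0"
  shows "pderiv_at k (\<lambda>z. c / (\<psi> z)\<^sup>2) x = - 2 * c * pderiv_at k \<psi> x / (\<psi> x) ^ 3"
proof (rule pderiv_at_eqI)
  have d: "((\<lambda>t. \<psi> (x + t *\<^sub>R axis k 1)) has_real_derivative pderiv_at k \<psi> x) (at 0)"
    using has_real_derivative_pderiv_at[of \<psi> x 0 k] assms(1) by simp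
  show "((\<lambda>t. c / (\<psi> (x + t *\<^sub>R axis k 1))\<^sup>2) has_real_derivative
      - 2 * c * pderiv_at k \<psi> x / (\<psi> x) ^ 3) (at 0)"
    using assms(2)
    by (auto intro!: derivative_eq_intros d simp: field_simps power2_eq_square power3_eq_cube)
qed

locale conformally_flat =
  fixes \<epsilon> :: "'k::finite \<Rightarrow> real" and \<psi> :: "real^'k \<Rightarrow> real"
  assumes sign: "\<And>i. \<epsilon> i = 1 \<or> \<epsilon> i = -1"
    and smooth: "smooth_fun_on UNIV \<psi>"
    and nonzero: "\<And>x. \<psi> x \<noteq> 0"
begin

abbreviation G :: "real^'k \<Rightarrow> real^'k^'k" where
  "G \<equiv> conformally_flat_metric \<epsilon> \<psi>"

text \<open>The logarithmic differential of \<open>\<psi>\<close>. Every Christoffel symbol of \<open>G\<close> is a signed sum of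
  components of \<open>u\<close>, so \<open>u\<close> rather than \<open>\<psi>\<close> is the natural variable for the curvature.\<close>

definition u :: "'k \<Rightarrow> real^'k \<Rightarrow> real" where
  "u k x = pderiv_at k \<psi> x / \<psi> x"

definition grad_sq :: "(real^'k \<Rightarrow> real) \<Rightarrow> real^'k \<Rightarrow> real" where
  "grad_sq f x = (\<Sum>k\<in>UNIV. \<epsilon> k * (pderiv_at k f x)\<^sup>2)"

definition laplacian :: "(real^'k \<Rightarrow> real) \<Rightarrow> real^'k \<Rightarrow> real" where
  "laplacian f x = (\<Sum>k\<in>UNIV. \<epsilon> k * pderiv_at k (pderiv_at k f) x)"

lemma sign_mult_self [simp]: "\<epsilon> i * \<epsilon> i = 1" "\<epsilon> i * (\<epsilon> i * a) = a"
  using sign[of i] by auto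

lemma G_mult_inverse:
  "G x ** ((\<psi> x)\<^sup>2 *\<^sub>R (\<chi> i j. if i = j then \<epsilon> i else 0)) = mat 1"
  using nonzero[of x]
  by (simp add: vec_eq_iff mat_def matrix_matrix_mult_def conformally_flat_metric_def
      if_distrib[of "\<lambda>a. _ * a"] if_distrib[of "\<lambda>a. a * _"] cong: if_cong)

lemma matrix_inv_G: "matrix_inv (G x) = (\<psi> x)\<^sup>2 *\<^sub>R (\<chi> i j. if i = j then \<epsilon> i else 0)"
  by (rule matrix_inv_eqI[OF G_mult_inverse])

lemma invertible_G: "invertible (G x)"
  using G_mult_inverse invertible_right_inverse by blast

lemma differentiable_psi:
  "\<psi> differentiable at x" "pderiv_at i \<psi> differentiable at x"
  using smooth_fun_on_differentiable[OF smooth] by auto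

lemma pderiv_at_G:
  "pderiv_at k (\<lambda>z. G z $ i $ j) x
    = (if i = j then - 2 * \<epsilon> i * pderiv_at k \<psi> x / (\<psi> x) ^ 3 else 0)"
  using pderiv_at_inverse_square[OF differentiable_psi(1) nonzero, of k "\<epsilon> i" x]
  by (cases "i = j") (simp_all add: conformally_flat_metric_def)

lemma christoffel_G:
  "christoffel G l i j x =
     (if i = j then \<epsilon> i * \<epsilon> l * u l x else 0) - (if l = j then u i x else 0)
     - (if l = i then u j x else 0)"
proof -
  let ?D = "\<lambda>k i j. pderiv_at k (\<lambda>z. G z $ i $ j) x"
  have "christoffel G l i j x = (\<psi> x)\<^sup>2 * \<epsilon> l * (?D i j l + ?D j i l - ?D l i j) / 2"
    by (simp add: christoffel_def matrix_inv_G if_distrib[of "\<lambda>a. _ * a"]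
        if_distrib[of "\<lambda>a. a * _"] cong: if_cong)
  also have "\<dots> = (if i = j then \<epsilon> i * \<epsilon> l * u l x else 0) - (if l = j then u i x else 0)
     - (if l = i then u j x else 0)"
    using nonzero[of x]
    by (auto simp: pderiv_at_G u_def field_simps power2_eq_square power3_eq_cube)
  finally show ?thesis .
qed

lemma has_real_derivative_u:
  "((\<lambda>t. u j (x + t *\<^sub>R axis i 1)) has_real_derivative
     pderiv_at i (pderiv_at j \<psi>) x / \<psi> x - u i x * u j x) (at 0)"
proof -
  have d: "((\<lambda>t. \<psi> (x + t *\<^sub>R axis i 1)) has_real_derivative pderiv_at i \<psi> x) (at 0)"
    "((\<lambda>t. pderiv_at j \<psi> (x + t *\<^sub>R axis i 1)) has_real_derivative
       pderiv_at i (pderiv_at j \<psi>) x) (at 0)"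
    using has_real_derivative_pderiv_at[of \<psi> x 0 i]
      has_real_derivative_pderiv_at[of "pderiv_at j \<psi>" x 0 i] differentiable_psi by simp_all
  show ?thesis
    unfolding u_def using nonzero
    by (auto intro!: derivative_eq_intros d simp: field_simps power2_eq_square)
qed

lemma pderiv_at_christoffel_G:
  "pderiv_at a (christoffel G l i j) x =
     (if i = j then \<epsilon> i * \<epsilon> l * (pderiv_at a (pderiv_at l \<psi>) x / \<psi> x - u a x * u l x) else 0)
     - (if l = j then pderiv_at a (pderiv_at i \<psi>) x / \<psi> x - u a x * u i x else 0)
     - (if l = i then pderiv_at a (pderiv_at j \<psi>) x / \<psi> x - u a x * u j x else 0)"
  unfolding christoffel_G[abs_def]
  by (rule pderiv_at_eqI) (auto intro!: derivative_eq_intros has_real_derivative_u)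

lemma sum_delta_mult [simp]:
  fixes f :: "'k \<Rightarrow> real"
  shows "(\<Sum>i\<in>UNIV. (if i = j then f i else 0) * g i) = f j * g j"
    "(\<Sum>i\<in>UNIV. (if j = i then f i else 0) * g i) = f j * g j"
    "(\<Sum>i\<in>UNIV. g i * (if i = j then f i else 0)) = g j * f j"
    "(\<Sum>i\<in>UNIV. g i * (if j = i then f i else 0)) = g j * f j"
  by (simp_all add: if_distrib[of "\<lambda>a. _ * a"] if_distrib[of "\<lambda>a. a * _"] cong: if_cong)

lemma sum_christoffel_G_trace:
  "(\<Sum>i\<in>UNIV. christoffel G i i k x) = - real CARD('k) * u k x"
proof -
  have "christoffel G i i k x = - u k x" for i
    by (auto simp: christoffel_G)
  thus ?thesis by simp
qed

lemma u_sq: "(\<Sum>i\<in>UNIV. \<epsilon> i * (u i x * u i x)) = grad_sq \<psi> x / (\<psi> x)\<^sup>2"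
  by (simp add: u_def grad_sq_def sum_divide_distrib power2_eq_square)

lemma sum_u_christoffel_G:
  "(\<Sum>s\<in>UNIV. u s x * christoffel G s j k x)
    = (if j = k then \<epsilon> j * grad_sq \<psi> x / (\<psi> x)\<^sup>2 else 0) - 2 * u j x * u k x"
proof -
  have "(\<Sum>s\<in>UNIV. u s x * (if j = k then \<epsilon> j * \<epsilon> s * u s x else 0))
      = (if j = k then \<epsilon> j * (\<Sum>s\<in>UNIV. \<epsilon> s * (u s x * u s x)) else 0)"
    by (simp add: sum_distrib_left mult_ac)
  thus ?thesis
    unfolding christoffel_G by (simp add: right_diff_distrib sum_subtractf u_sq)
qed

text \<open>Each of the three terms of \<open>\<Gamma>\<^sup>i\<^sub>j\<^sub>s\<close> is contracted separately with \<open>\<Gamma>\<^sup>s\<^sub>i\<^sub>k\<close>: the Kronecker deltas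
  reduce two of the double sums to the traces above, and in the third the \<open>u\<^sub>j u\<^sub>k\<close> terms cancel.\<close>

lemma sum_christoffel_G_square:
  "(\<Sum>i\<in>UNIV. \<Sum>s\<in>UNIV. christoffel G i j s x * christoffel G s i k x)
    = (real CARD('k) + 2) * u j x * u k x
      - 2 * (if j = k then \<epsilon> j * grad_sq \<psi> x / (\<psi> x)\<^sup>2 else 0)"
proof -
  let ?\<Gamma> = "\<lambda>l i j. christoffel G l i j x"
  have inner: "(\<Sum>s\<in>UNIV. ?\<Gamma> i j s * ?\<Gamma> s i k)
      = \<epsilon> j * \<epsilon> i * u i x * ?\<Gamma> j i k - u j x * ?\<Gamma> i i k
        - (if i = j then (\<Sum>s\<in>UNIV. u s x * ?\<Gamma> s i k) else 0)" for i
  proof -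
    have "(\<Sum>s\<in>UNIV. ?\<Gamma> i j s * ?\<Gamma> s i k) =
        (\<Sum>s\<in>UNIV. (if j = s then \<epsilon> j * \<epsilon> i * u i x else 0) * ?\<Gamma> s i k
          - (if i = s then u j x else 0) * ?\<Gamma> s i k
          - (if i = j then u s x * ?\<Gamma> s i k else 0))"
      by (intro sum.cong refl) (auto simp: christoffel_G[of i j] algebra_simps)
    thus ?thesis by (simp add: sum_subtractf)
  qed
  have "(\<Sum>i\<in>UNIV. \<epsilon> j * \<epsilon> i * u i x * ?\<Gamma> j i k)
     = (\<Sum>i\<in>UNIV. (if i = k then u k x * u j x else 0) - (if i = j then u j x * u k x else 0)
          - (if j = k then \<epsilon> j * (\<epsilon> i * (u i x * u i x)) else 0))"
    by (intro sum.cong refl) (auto simp: christoffel_G algebra_simps)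
  also have "\<dots> = - (if j = k then \<epsilon> j * grad_sq \<psi> x / (\<psi> x)\<^sup>2 else 0)"
    by (simp add: sum_subtractf u_sq flip: sum_distrib_left)
  finally have last: "(\<Sum>i\<in>UNIV. \<epsilon> j * \<epsilon> i * u i x * ?\<Gamma> j i k)
     = - (if j = k then \<epsilon> j * grad_sq \<psi> x / (\<psi> x)\<^sup>2 else 0)" .
  have "(\<Sum>i\<in>UNIV. u j x * ?\<Gamma> i i k) = - real CARD('k) * u j x * u k x"
    using sum_christoffel_G_trace[of k x] by (simp flip: sum_distrib_left)
  moreover have "(\<Sum>i\<in>UNIV. if i = j then (\<Sum>s\<in>UNIV. u s x * ?\<Gamma> s i k) else 0)
      = (if j = k then \<epsilon> j * grad_sq \<psi> x / (\<psi> x)\<^sup>2 else 0) - 2 * u j x * u k x"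
    by (simp add: sum_u_christoffel_G)
  ultimately show ?thesis
    by (simp only: inner sum_subtractf last) (simp add: algebra_simps)
qed

text \<open>Writing \<open>D\<^sub>a\<^sub>b = \<partial>\<^sub>a u\<^sub>b = \<psi>\<^sub>a\<^sub>b / \<psi> - u\<^sub>a u\<^sub>b\<close>, the derivative terms contribute \<open>(n - 2) D\<^sub>j\<^sub>k\<close> and the
  quadratic ones \<open>(n - 2) u\<^sub>j u\<^sub>k\<close>, besides multiples of \<open>\<epsilon>\<^sub>j \<delta>\<^sub>j\<^sub>k\<close>; the two combine to \<open>(n - 2) \<psi>\<^sub>j\<^sub>k / \<psi>\<close>.
  The trace of the derivatives produces both \<open>D\<^sub>j\<^sub>k\<close> and \<open>D\<^sub>k\<^sub>j\<close>, so the commutation of partial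
  derivatives is essential here.\<close>

lemma ricci_G:
  "ricci G x $ j $ k = (real CARD('k) - 2) * pderiv_at j (pderiv_at k \<psi>) x / \<psi> x
     + (if j = k then \<epsilon> j * (laplacian \<psi> x / \<psi> x
          - (real CARD('k) - 1) * grad_sq \<psi> x / (\<psi> x)\<^sup>2) else 0)"
proof -
  let ?n = "real CARD('k)" and ?\<Gamma> = "\<lambda>l i j. christoffel G l i j x"
  define D where "D a b = pderiv_at a (pderiv_at b \<psi>) x / \<psi> x - u a x * u b x" for a b
  have dG: "pderiv_at a (christoffel G l i j) x = (if i = j then \<epsilon> i * \<epsilon> l * D a l else 0)
     - (if l = j then D a i else 0) - (if l = i then D a j else 0)" for a l i j
    by (simp add: pderiv_at_christoffel_G D_def)
  have D_commute: "D a b = D b a" for a b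
    using pderiv_at_commute[OF smooth, of x a b] by (simp add: D_def)
  have D_trace: "(\<Sum>i\<in>UNIV. \<epsilon> i * D i i) = laplacian \<psi> x / \<psi> x - grad_sq \<psi> x / (\<psi> x)\<^sup>2"
    by (simp add: D_def right_diff_distrib sum_subtractf u_sq laplacian_def sum_divide_distrib)
  have 1: "(\<Sum>i\<in>UNIV. pderiv_at i (christoffel G i j k) x)
      = (if j = k then \<epsilon> j * (laplacian \<psi> x / \<psi> x - grad_sq \<psi> x / (\<psi> x)\<^sup>2) else 0) - 2 * D j k"
    unfolding D_trace[symmetric]
    by (simp add: dG sum_subtractf sum_distrib_left mult.assoc D_commute[of k j])
  have "pderiv_at j (christoffel G i i k) x = - D j k" for i
    by (auto simp: dG)
  hence 2: "(\<Sum>i\<in>UNIV. pderiv_at j (christoffel G i i k) x) = - ?n * D j k" by simp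
  have "(\<Sum>i\<in>UNIV. \<Sum>s\<in>UNIV. ?\<Gamma> i i s * ?\<Gamma> s j k) = (\<Sum>s\<in>UNIV. (\<Sum>i\<in>UNIV. ?\<Gamma> i i s) * ?\<Gamma> s j k)"
    by (subst sum.swap) (simp add: sum_distrib_right)
  also have "\<dots> = - ?n * (\<Sum>s\<in>UNIV. u s x * ?\<Gamma> s j k)"
    by (simp add: sum_christoffel_G_trace sum_distrib_left mult.assoc sum_negf)
  finally have 3: "(\<Sum>i\<in>UNIV. \<Sum>s\<in>UNIV. ?\<Gamma> i i s * ?\<Gamma> s j k)
      = - ?n * ((if j = k then \<epsilon> j * grad_sq \<psi> x / (\<psi> x)\<^sup>2 else 0) - 2 * u j x * u k x)"
    by (simp only: sum_u_christoffel_G)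
  have "ricci G x $ j $ k = 
      (if j = k then \<epsilon> j * (laplacian \<psi> x / \<psi> x - grad_sq \<psi> x / (\<psi> x)\<^sup>2) else 0) - 2 * D j k
      + ?n * D j k
      + (- ?n * ((if j = k then \<epsilon> j * grad_sq \<psi> x / (\<psi> x)\<^sup>2 else 0) - 2 * u j x * u k x))
      - ((?n + 2) * u j x * u k x
        - 2 * (if j = k then \<epsilon> j * grad_sq \<psi> x / (\<psi> x)\<^sup>2 else 0))"
    unfolding ricci_def riemann_def
    by (simp add: sum.distrib sum_subtractf 1 2 3 sum_christoffel_G_square)
  also have "\<dots> = (?n - 2) * (D j k + u j x * u k x)
      + (if j = k then \<epsilon> j * (laplacian \<psi> x / \<psi> x - (?n - 1) * grad_sq \<psi> x / (\<psi> x)\<^sup>2) else 0)"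
    by (simp add: algebra_simps diff_divide_distrib add_divide_distrib)
  finally show ?thesis by (simp add: D_def)
qed

lemma scalar_curvature_G:
  "scalar_curvature G x
    = (real CARD('k) - 1) * (2 * \<psi> x * laplacian \<psi> x - real CARD('k) * grad_sq \<psi> x)"
proof -
  let ?n = "real CARD('k)"
  have "scalar_curvature G x = (\<Sum>i\<in>UNIV. (\<psi> x)\<^sup>2 * \<epsilon> i * ricci G x $ i $ i)"
    by (simp add: scalar_curvature_def matrix_inv_G if_distrib[of "\<lambda>a. _ * a"]
        if_distrib[of "\<lambda>a. a * _"] cong: if_cong)
  also have "\<dots> = (\<Sum>i\<in>UNIV. (?n - 2) * \<psi> x * (\<epsilon> i * pderiv_at i (pderiv_at i \<psi>) x)
      + (\<psi> x * laplacian \<psi> x - (?n - 1) * grad_sq \<psi> x))"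
  proof (rule sum.cong[OF refl])
    fix i
    show "(\<psi> x)\<^sup>2 * \<epsilon> i * ricci G x $ i $ i = (?n - 2) * \<psi> x * (\<epsilon> i * pderiv_at i (pderiv_at i \<psi>) x)
      + (\<psi> x * laplacian \<psi> x - (?n - 1) * grad_sq \<psi> x)"
      using nonzero[of x] sign[of i] by (auto simp: ricci_G field_simps power2_eq_square)
  qed
  also have "\<dots> = (?n - 2) * \<psi> x * laplacian \<psi> x
      + ?n * (\<psi> x * laplacian \<psi> x - (?n - 1) * grad_sq \<psi> x)"
    by (simp add: sum.distrib laplacian_def flip: sum_distrib_left)
  finally show ?thesis by (simp add: algebra_simps)
qed

lemma hessian_G:
  "hessian G f x $ i $ j = pderiv_at i (pderiv_at j f) x + u i x * pderiv_at j f x + u j x * pderiv_at i f x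
    - (if i = j then \<epsilon> i * (\<Sum>k\<in>UNIV. \<epsilon> k * (u k x * pderiv_at k f x)) else 0)"
proof -
  have "(\<Sum>l\<in>UNIV. (if i = j then \<epsilon> i * \<epsilon> l * u l x else 0) * pderiv_at l f x)
      = (if i = j then \<epsilon> i * (\<Sum>k\<in>UNIV. \<epsilon> k * (u k x * pderiv_at k f x)) else 0)"
    by (simp add: sum_distrib_left mult_ac)
  thus ?thesis
    by (simp add: hessian_def christoffel_G left_diff_distrib sum_subtractf)
qed

end

context conformally_flat
begin

text \<open>The off-diagonal entries of the equation are cleared of denominators by \<open>\<psi>\<close>, the diagonal ones
  by \<open>\<psi>\<^sup>2\<close>. The factor \<open>\<mu>\<close> is a mere number because the equation is considered at a single point.\<close>

lemma conformal_soliton_equation_iff: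
  "ricci G x + hessian G h x = \<mu> *\<^sub>R G x \<longleftrightarrow>
    (\<forall>i j. i \<noteq> j \<longrightarrow>
       (real CARD('k) - 2) * pderiv_at j (pderiv_at i \<psi>) x + \<psi> x * pderiv_at j (pderiv_at i h) x
       + pderiv_at i \<psi> x * pderiv_at j h x + pderiv_at j \<psi> x * pderiv_at i h x = 0) \<and>
    (\<forall>i. \<epsilon> i * (\<psi> x * laplacian \<psi> x - (real CARD('k) - 1) * grad_sq \<psi> x
            - \<psi> x * (\<Sum>k\<in>UNIV. \<epsilon> k * (pderiv_at k \<psi> x * pderiv_at k h x)))
         + ((real CARD('k) - 2) * \<psi> x * pderiv_at i (pderiv_at i \<psi>) x
            + (\<psi> x)\<^sup>2 * pderiv_at i (pderiv_at i h) x
            + 2 * \<psi> x * pderiv_at i \<psi> x * pderiv_at i h x)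
         = \<mu> * \<epsilon> i)"
    (is "_ \<longleftrightarrow> (\<forall>i j. i \<noteq> j \<longrightarrow> ?off i j = 0) \<and> (\<forall>i. ?diag i = \<mu> * \<epsilon> i)")
proof -
  let ?E = "ricci G x + hessian G h x - \<mu> *\<^sub>R G x"
  \<comment> \<open>entry \<open>(j, i)\<close>, since \<open>ricci_G\<close> and \<open>hessian_G\<close> at \<open>(j, i)\<close> give the derivatives in the order of \<open>?off i j\<close>\<close>
  have off: "?E $ j $ i = ?off i j / \<psi> x" if "i \<noteq> j" for i j
    using that nonzero[of x]
    by (simp add: ricci_G hessian_G conformally_flat_metric_def u_def field_simps)
  have inner: "(\<Sum>k\<in>UNIV. \<epsilon> k * (u k x * pderiv_at k h x))
      = (\<Sum>k\<in>UNIV. \<epsilon> k * (pderiv_at k \<psi> x * pderiv_at k h x)) / \<psi> x"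
    by (simp add: u_def sum_divide_distrib)
  have diag: "?E $ i $ i = (?diag i - \<mu> * \<epsilon> i) / (\<psi> x)\<^sup>2" for i
    using nonzero[of x]
    by (simp add: ricci_G hessian_G inner conformally_flat_metric_def)
      (simp add: u_def field_simps power2_eq_square)
  have "ricci G x + hessian G h x = \<mu> *\<^sub>R G x \<longleftrightarrow> (\<forall>j i. ?E $ j $ i = 0)"
    by (simp add: vec_eq_iff)
  also have "\<dots> \<longleftrightarrow> (\<forall>i j. i \<noteq> j \<longrightarrow> ?E $ j $ i = 0) \<and> (\<forall>i. ?E $ i $ i = 0)"
    by metis
  also have "\<dots> \<longleftrightarrow> (\<forall>i j. i \<noteq> j \<longrightarrow> ?off i j = 0) \<and> (\<forall>i. ?diag i = \<mu> * \<epsilon> i)"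
    using nonzero[of x] by (simp add: off diag del: vector_add_component vector_minus_component)
  finally show ?thesis .
qed

end

section \<open>Charts of a product and Einstein fibres\<close>

lemma join_coords_part [simp]:
  "left_part (join_coords u v) = u" "right_part (join_coords u v) = v"
  "join_coords (left_part z) (right_part z) = z"
  by (simp_all add: vec_eq_iff left_part_def right_part_def join_coords_def all_Plus)

lemma continuous_on_right_part: "continuous_on UNIV right_part"
  unfolding right_part_def by (intro continuous_intros)

lemma chart_img_product:
  "chart_img (product_manifold M N) (c, d)
    = {z. left_part z \<in> chart_img M c \<and> right_part z \<in> chart_img N d}"
proof (intro equalityI subsetI)
  fix z assume "z \<in> {z. left_part z \<in> chart_img M c \<and> right_part z \<in> chart_img N d}"
  then obtain p q where "p \<in> chart_dom M c" "left_part z = chart M c p"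
    "q \<in> chart_dom N d" "right_part z = chart N d q"
    by (auto simp: chart_img_def)
  thus "z \<in> chart_img (product_manifold M N) (c, d)"
    using join_coords_part(3)[of z]
    by (force simp: chart_img_def product_manifold_def image_iff intro!: bexI[of _ "(p, q)"])
qed (auto simp: chart_img_def product_manifold_def)

text \<open>\<open>param\<close> chooses a preimage under the product chart, and the base part of the coordinates of
  any preimage of \<open>z\<close> is \<open>left_part z\<close>.\<close>

lemma chart_fst_param_product:
  assumes "z \<in> chart_img (product_manifold M N) (c, d)"
  shows "chart M c (fst (param (product_manifold M N) (c, d) z)) = left_part z"
proof -
  have "chart (product_manifold M N) (c, d) (param (product_manifold M N) (c, d) z) = z"
    using assms unfolding param_def chart_img_def by (rule f_inv_into_f)
  hence "left_part (chart (product_manifold M N) (c, d) (param (product_manifold M N) (c, d) z))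
      = left_part z"
    by simp
  thus ?thesis
    by (cases "param (product_manifold M N) (c, d) z") (simp add: product_manifold_def)
qed

lemma metric_conformal_pseudo_euclidean:
  "metric (conformal_change \<psi> (pseudo_euclidean \<epsilon>)) c = conformally_flat_metric \<epsilon> \<psi>"
proof -
  have "inv_into UNIV (\<lambda>x. x) y = y" for y :: "real^'k::finite"
    using inv_f_f[of "\<lambda>x. x" y] by simp
  thus ?thesis
    by (simp add: fun_eq_iff conformal_change_def pseudo_euclidean_def conformally_flat_metric_def
        param_def)
qed

lemma metric_product:
  "metric (product_manifold M N) (c, d) = block_metric (metric M c) (metric N d)"
  by (simp add: fun_eq_iff product_manifold_def block_metric_def block_matrix_def)

lemma block_matrix_eq_iff:
  "block_matrix A B = block_matrix A' B' \<longleftrightarrow> A = A' \<and> B = B'"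
  by (auto simp: vec_eq_iff all_Plus)

text \<open>The trace of \<open>lam *\<^sub>R G\<close> is taken with the inverse metric; symmetry turns the contraction into
  the trace of the identity matrix.\<close>

lemma scalar_curvature_einstein:
  fixes G :: "real^'k \<Rightarrow> real^'k^'k::finite"
  assumes "invertible (G y)" "transpose (G y) = G y" and "ricci G y = lam *\<^sub>R G y"
  shows "scalar_curvature G y = lam * real CARD('k)"
proof -
  have sym: "G y $ i $ j = G y $ j $ i" for i j
    using assms(2) by (metis transpose_def vec_lambda_beta)
  have "(matrix_inv (G y) ** G y) $ i $ i = 1" for i
    using assms(1) by (simp add: matrix_inv_inverse mat_def)
  hence "(\<Sum>j\<in>UNIV. matrix_inv (G y) $ i $ j * G y $ i $ j) = 1" for i
    by (simp add: matrix_matrix_mult_def sym[of i])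
  hence "(\<Sum>i\<in>UNIV. lam * (\<Sum>j\<in>UNIV. matrix_inv (G y) $ i $ j * G y $ i $ j)) = lam * real CARD('k)"
    by simp
  thus ?thesis
    by (simp add: scalar_curvature_def assms(3) sum_distrib_left mult_ac)
qed

text \<open>An invertible matrix is not zero because index types are not empty.\<close>

lemma invertible_scaleR_cancel:
  fixes A :: "real^'k^'k::finite"
  assumes "invertible A"
  shows "a *\<^sub>R A = b *\<^sub>R A \<longleftrightarrow> a = b"
proof -
  have "A \<noteq> 0"
  proof
    assume "A = 0"
    hence "(mat 1 :: real^'k^'k) = 0" using matrix_inv_inverse(1)[OF assms] by simp
    hence "(mat 1 :: real^'k^'k) $ i $ i = 0" for i by simp
    thus False by (simp add: mat_def)
  qed
  thus ?thesis by simp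
qed

section \<open>The soliton equation on the product\<close>

theorem theorem2p1:
  fixes \<epsilon> :: "'n::finite \<Rightarrow> real"
    and F :: "('c, 'f::{t2_space,second_countable_topology}, 'm::finite) manifold_data"
    and \<psi> h :: "real^'n \<Rightarrow> real"
    and lamF \<rho> lam :: real
    and n m :: nat
  assumes dim_n: "n = CARD('n)" "n \<ge> 3"
    and dim_m: "m = CARD('m)"
    and eps: "\<And>i. \<epsilon> i = 1 \<or> \<epsilon> i = -1"
    and eps_pos: "\<exists>i. \<epsilon> i = 1"
    and F_einstein: "einstein_manifold F lamF"
    and psi_smooth: "smooth_fun_on UNIV \<psi>"
    and h_smooth: "smooth_fun_on UNIV h"
    and psi_nonzero: "\<And>x. \<psi> x \<noteq> 0"
  shows "gradient_rho_einstein_soliton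
           (product_manifold (conformal_change \<psi> (pseudo_euclidean \<epsilon>)) F) \<rho> (h \<circ> fst) lam
    \<longleftrightarrow>
      (\<forall>x i j. i \<noteq> j \<longrightarrow>
         (real n - 2) * pderiv_at j (pderiv_at i \<psi>) x + \<psi> x * pderiv_at j (pderiv_at i h) x
         + pderiv_at i \<psi> x * pderiv_at j h x + pderiv_at j \<psi> x * pderiv_at i h x = 0)
      \<and>
      (\<forall>x i.
         \<epsilon> i * (\<Sum>k\<in>UNIV. \<epsilon> k *
             (\<psi> x * pderiv_at k (pderiv_at k \<psi>) x - (real n - 1) * (pderiv_at k \<psi> x)\<^sup>2
              - \<psi> x * pderiv_at k \<psi> x * pderiv_at k h x
              - 2 * (real n - 1) * \<rho> * \<psi> x * pderiv_at k (pderiv_at k \<psi>) x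
              + (real n - 1) * real n * \<rho> * (pderiv_at k \<psi> x)\<^sup>2))
         + ((real n - 2) * \<psi> x * pderiv_at i (pderiv_at i \<psi>) x
            + (\<psi> x)\<^sup>2 * pderiv_at i (pderiv_at i h) x
            + 2 * \<psi> x * pderiv_at i \<psi> x * pderiv_at i h x)
         = (lamF * real m * \<rho> + lam) * \<epsilon> i)
      \<and>
      (\<forall>x. (\<Sum>k\<in>UNIV. \<epsilon> k *
             ((real n - 1) * real n * \<rho> * (pderiv_at k \<psi> x)\<^sup>2
              - 2 * (real n - 1) * \<rho> * \<psi> x * pderiv_at k (pderiv_at k \<psi>) x))
         = lamF * (real m * \<rho> - 1) + lam)"
    (is "?soliton \<longleftrightarrow> (\<forall>x i j. i \<noteq> j \<longrightarrow> ?off x i j = 0) \<and>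
           (\<forall>x i. \<epsilon> i * ?S x + ?T x i = _ * \<epsilon> i) \<and> (\<forall>x. ?U x = _)")
proof -
  interpret conformally_flat \<epsilon> \<psi>
    using eps psi_smooth psi_nonzero by unfold_locales
  let ?B = "conformal_change \<psi> (pseudo_euclidean \<epsilon>)"
  let ?M = "product_manifold ?B F"
  define \<mu> where "\<mu> x = \<rho> * (scalar_curvature G x + lamF * real m) + lam" for x
  have ricci_F: "ricci (metric F d) y = lamF *\<^sub>R metric F d y" if "y \<in> chart_img F d" for d y
    using F_einstein that by (auto simp: einstein_manifold_def semi_riemannian_manifold_def)
  have inv_F: "invertible (metric F d y)" and sym_F: "transpose (metric F d y) = metric F d y"
    if "y \<in> chart_img F d" for d y
    using F_einstein that
    by (auto simp: einstein_manifold_def semi_riemannian_manifold_def metric_tensor_def)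
  have open_F: "open (chart_img F d)" for d
    using F_einstein
    by (auto simp: einstein_manifold_def semi_riemannian_manifold_def smooth_atlas_def)
  have "(\<Union>c. chart_dom F c) = UNIV"
    using F_einstein
    by (auto simp: einstein_manifold_def semi_riemannian_manifold_def smooth_atlas_def)
  then obtain d0 p0 where "p0 \<in> chart_dom F d0" by blast
  hence y0: "chart F d0 p0 \<in> chart_img F d0" by (simp add: chart_img_def)
  have chart_B: "chart ?B c x = x" for c x
    by (simp add: conformal_change_def pseudo_euclidean_def)
  have img: "chart_img ?M (c, d) = {z. right_part z \<in> chart_img F d}" for c d
    by (auto simp: chart_img_product) (simp add: chart_img_def conformal_change_def pseudo_euclidean_def)
  have metric: "metric ?M (c, d) = block_metric G (metric F d)" for c d
    by (simp add: metric_product metric_conformal_pseudo_euclidean)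
  have pointwise: "ricci (metric ?M (c, d)) z + hessian (metric ?M (c, d)) ((h \<circ> fst) \<circ> param ?M (c, d)) z
        = (\<rho> * scalar_curvature (metric ?M (c, d)) z + lam) *\<^sub>R metric ?M (c, d) z
      \<longleftrightarrow> ricci G (left_part z) + hessian G h (left_part z) = \<mu> (left_part z) *\<^sub>R G (left_part z)
          \<and> lamF = \<mu> (left_part z)"
    if z: "right_part z \<in> chart_img F d" for c d z
  proof -
    let ?S = "{z :: real^('n + 'm). right_part z \<in> chart_img F d}"
    let ?x = "left_part z" and ?y = "right_part z"
    have S: "open ?S" "z \<in> ?S"
      using continuous_open_preimage[OF continuous_on_right_part open_UNIV open_F] z
      by (auto simp: vimage_def)
    have fib: "\<And>z. z \<in> ?S \<Longrightarrow> invertible (metric F d (right_part z))"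
      using inv_F by simp
    have "fst (param ?M (c, d) z) = left_part z" if "z \<in> ?S" for z
      using chart_fst_param_product[of z ?B F c d] that
      by (simp only: img chart_B)
    hence "hessian (metric ?M (c, d)) ((h \<circ> fst) \<circ> param ?M (c, d)) z
        = hessian (metric ?M (c, d)) (\<lambda>z. h (left_part z)) z"
      by (intro hessian_cong[OF S]) simp
    also have "\<dots> = block_matrix (hessian G h ?x) 0"
      unfolding metric using invertible_G inv_F[OF z] by (rule hessian_block_metric_left)
    finally have hess: "hessian (metric ?M (c, d)) ((h \<circ> fst) \<circ> param ?M (c, d)) z
        = block_matrix (hessian G h ?x) 0" .
    have ric: "ricci (metric ?M (c, d)) z = block_matrix (ricci G ?x) (lamF *\<^sub>R metric F d ?y)"
      unfolding metric ricci_F[OF z, symmetric]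
      by (rule ricci_block_metric[where G = G and H = "metric F d", OF S invertible_G fib])
    have "scalar_curvature (metric ?M (c, d)) z
        = scalar_curvature G ?x + scalar_curvature (metric F d) ?y"
      unfolding metric by (rule scalar_curvature_block_metric[where G = G and H = "metric F d", OF S invertible_G fib])
    hence scal: "\<rho> * scalar_curvature (metric ?M (c, d)) z + lam = \<mu> ?x"
      using scalar_curvature_einstein[where G = "metric F d", OF inv_F[OF z] sym_F[OF z] ricci_F[OF z]]
      by (simp add: \<mu>_def dim_m)
    have add: "block_matrix A B + block_matrix A' 0 = block_matrix (A + A') B"
      and scale: "a *\<^sub>R block_matrix A B = block_matrix (a *\<^sub>R A) (a *\<^sub>R B)"
      for A A' :: "real^'n^'n" and B :: "real^'m^'m" and a
      by (simp_all add: vec_eq_iff all_Plus)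
    have met: "metric ?M (c, d) z = block_matrix (G ?x) (metric F d ?y)"
      by (simp add: metric block_metric_def)
    show ?thesis
      unfolding hess ric scal met add scale block_matrix_eq_iff
        invertible_scaleR_cancel[OF inv_F[OF z]] ..
  qed
  have "?soliton \<longleftrightarrow> (\<forall>d z. right_part z \<in> chart_img F d \<longrightarrow>
      ricci G (left_part z) + hessian G h (left_part z) = \<mu> (left_part z) *\<^sub>R G (left_part z)
          \<and> lamF = \<mu> (left_part z))"
    using pointwise by (simp add: gradient_rho_einstein_soliton_def img)
  also have "\<dots> \<longleftrightarrow> (\<forall>x. ricci G x + hessian G h x = \<mu> x *\<^sub>R G x \<and> lamF = \<mu> x)"
    (is "?lhs \<longleftrightarrow> ?rhs")
  proof
    show "?rhs" if "?lhs"
    proof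
      fix x
      show "ricci G x + hessian G h x = \<mu> x *\<^sub>R G x \<and> lamF = \<mu> x"
        using that[rule_format, of "join_coords x (chart F d0 p0)" d0] y0 by simp
    qed
  qed simp
  also have "\<dots> \<longleftrightarrow> (\<forall>x. (\<forall>i j. i \<noteq> j \<longrightarrow> ?off x i j = 0) \<and>
           (\<forall>i. \<epsilon> i * ?S x + ?T x i = (lamF * real m * \<rho> + lam) * \<epsilon> i) \<and>
           ?U x = lamF * (real m * \<rho> - 1) + lam)"
  proof (rule arg_cong[of _ _ All], rule ext)
    fix x
    \<comment> \<open>the part of \<open>\<mu>\<close> that depends on \<open>\<psi>\<close> is exactly \<open>- ?U\<close>\<close>
    have \<mu>: "\<mu> x = \<rho> * (real n - 1) * (2 * \<psi> x * laplacian \<psi> x - real n * grad_sq \<psi> x)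
        + (lamF * real m * \<rho> + lam)"
      by (simp add: \<mu>_def scalar_curvature_G dim_n algebra_simps)
    have U: "?U x = - \<rho> * (real n - 1) * (2 * \<psi> x * laplacian \<psi> x - real n * grad_sq \<psi> x)"
      unfolding laplacian_def grad_sq_def sum_distrib_left sum_subtractf[symmetric]
        sum.distrib[symmetric]
      by (intro sum.cong refl) (simp add: algebra_simps power2_eq_square)
    have S: "?S x = (\<psi> x * laplacian \<psi> x - (real n - 1) * grad_sq \<psi> x
            - \<psi> x * (\<Sum>k\<in>UNIV. \<epsilon> k * (pderiv_at k \<psi> x * pderiv_at k h x))) + ?U x"
      unfolding laplacian_def grad_sq_def sum_distrib_left sum_subtractf[symmetric]
        sum.distrib[symmetric]
      by (intro sum.cong refl) (simp add: algebra_simps power2_eq_square)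
    have "lamF = \<mu> x \<longleftrightarrow> ?U x = lamF * (real m * \<rho> - 1) + lam"
      unfolding U \<mu> by (auto simp: algebra_simps)
    moreover have "\<epsilon> i * A + ?T x i = \<mu> x * \<epsilon> i
        \<longleftrightarrow> \<epsilon> i * (A + ?U x) + ?T x i = (lamF * real m * \<rho> + lam) * \<epsilon> i" for i A
      unfolding U \<mu> by (simp add: algebra_simps)
    ultimately show "(ricci G x + hessian G h x = \<mu> x *\<^sub>R G x \<and> lamF = \<mu> x) \<longleftrightarrow>
        (\<forall>i j. i \<noteq> j \<longrightarrow> ?off x i j = 0) \<and>
        (\<forall>i. \<epsilon> i * ?S x + ?T x i = (lamF * real m * \<rho> + lam) * \<epsilon> i) \<and>
        ?U x = lamF * (real m * \<rho> - 1) + lam"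
      unfolding conformal_soliton_equation_iff S by (simp only: dim_n(1) conj_assoc)
  qed
  finally show ?thesis by (simp only: all_conj_distrib)
qed

end
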